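(* Let $d\ge2$ and let $Q_1,Q_2\subset\mathbb{RP}^d$ be two distinct non-empty non-degenerate quadrics. For $p\in Q_1$ such that $Q_2$ is not tangent to $Q_1$ at $p$, let $u$ be the pole of $T_pQ_1$ with respect to $Q_2$ (then $u\neq p$) and let $L_{Q_2}(p)$ be the line $pu$. Let $U\subset Q_1$ be the set of those $p$ for which $L_{Q_2}(p)$ is defined and transverse to $Q_1$ at $p$, and consider the line-framed hypersurface over $U$ $$\Sigma=\{(p,L_{Q_2}(p))\,:\,p\in U\}.$$ Then $Q_2$ is a caustic of $\Sigma$.
   Context: A quadric in $\mathbb{RP}^d$ is the zero set $\{[x]: q(x)=0\}$ of a non-zero quadratic form $q$ on $\mathbb{R}^{d+1}$; it is non-degenerate if $q$ is. For a non-degenerate form $q$ and a projective hyperplane $\mathbb{P}(W)$, the pole of $\mathbb{P}(W)$ with respect to $q$ (or to the non-empty quadric defined by $q$) is the point $\mathbb{P}(W^{\perp_q})$, where $W^{\perp_q}$ is the $q$-orthogonal of $W$. A line-framed hypersurface over a hypersurface $S\subset \mathbb{RP}^d$ is a field of lines $L(p)\ni p$, $p\in S$, with $L(p)$ transverse to $T_pS$ (identified with the set of pairs $(p,L(p))$). Projective reflection law at $p$: it is the unique non-trivial projective involution of the space of lines through $p$ fixing $L(p)$ and every line of $T_pS$ through $p$. Equivalently, a line $\ell\ni p$ transverse to $S$ is reflected into $\ell'\ni p$ if $\ell,\ell',L(p)$ lie in one plane $\mathcal{P}$ and the quadruple of lines $(\ell,\ell',L(p),T_pS\cap\mathcal{P})$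 is harmonic in $\mathcal{P}$ (i.e. $\ell,\ell'$ are exchanged by the non-trivial projective involution of the pencil of lines of $\mathcal P$ through $p$ fixing $L(p)$ and $T_pS\cap\mathcal{P}$). A hypersurface $\Gamma$ is a caustic of the line-framed hypersurface $\Sigma$ over $S$ if every line tangent to $\Gamma$ and intersecting $S$ transversally at a point $p$ is reflected into a line tangent to $\Gamma$ by the projective reflection law at $p$. *)

theory Defs
  imports "HOL-Analysis.Analysis"
begin

text \<open>
  The projective space \<open>P(V)\<close> of a Euclidean space \<open>V\<close> is modelled by linear subspaces of \<open>V\<close>:
  points, lines and hyperplanes are the subspaces of dimension 1, dimension 2 and codimension 1,
  and incidence is inclusion. A subset \<open>S\<close> of \<open>P(V)\<close> is a set of points; its cone in \<open>V\<close> is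
  \<open>\<Union>S\<close>. The real projective space of dimension \<open>d\<close> is the case where \<open>V\<close> has dimension \<open>d + 1\<close>.
\<close>

definition proj_points :: "'a::euclidean_space set set" where
  "proj_points = {p. subspace p \<and> dim p = 1}"

definition proj_lines :: "'a::euclidean_space set set" where
  "proj_lines = {l. subspace l \<and> dim l = 2}"

definition lines_through :: "'a::euclidean_space set \<Rightarrow> 'a set set" where
  "lines_through p = {l \<in> proj_lines. p \<subseteq> l}"

definition quadratic_form :: "('a::euclidean_space \<Rightarrow> real) \<Rightarrow> bool" where
  "quadratic_form q \<longleftrightarrow> (\<exists>B. bilinear B \<and> (\<forall>x. q x = B x x))"

definition polar_form :: "('a::euclidean_space \<Rightarrow> real) \<Rightarrow> 'a \<Rightarrow> 'a \<Rightarrow> real" where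
  "polar_form q x y = (q (x + y) - q x - q y) / 2"

definition nondegenerate_form :: "('a::euclidean_space \<Rightarrow> real) \<Rightarrow> bool" where
  "nondegenerate_form q \<longleftrightarrow>
     quadratic_form q \<and> (\<forall>x. (\<forall>y. polar_form q x y = 0) \<longrightarrow> x = 0)"

definition quadric :: "('a::euclidean_space \<Rightarrow> real) \<Rightarrow> 'a set set" where
  "quadric q = {p \<in> proj_points. \<forall>x\<in>p. q x = 0}"

definition pole :: "('a::euclidean_space \<Rightarrow> real) \<Rightarrow> 'a set \<Rightarrow> 'a set" where
  "pole q W = {x. \<forall>w\<in>W. polar_form q x w = 0}"

text \<open>
  \<open>S\<close> is an embedded hypersurface of class \<open>C\<^sup>1\<close> of \<open>P(V)\<close> iff its cone is one of \<open>V - {0}\<close>, i.e.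
  is locally the zero set of a \<open>C\<^sup>1\<close> function with nowhere vanishing gradient. It need not be closed.
\<close>
definition hypersurface :: "'a::euclidean_space set set \<Rightarrow> bool" where
  "hypersurface S \<longleftrightarrow> S \<subseteq> proj_points \<and>
     (\<forall>p\<in>S. \<forall>x\<in>p - {0}. \<exists>N f g. open N \<and> x \<in> N \<and>
        (\<forall>y\<in>N. GDERIV f y :> g y \<and> g y \<noteq> 0) \<and> continuous_on N g \<and>
        \<Union>S \<inter> N = {y \<in> N. f y = 0})"

text \<open>
  The linear subspace \<open>W\<close> of \<open>V\<close> such that \<open>P(W)\<close> is the projective tangent hyperplane of \<open>S\<close> at
  \<open>p\<close>: the velocities of curves drawn on the cone of \<open>S\<close> and starting at a non-zero vector of \<open>p\<close>.
\<close>
definition tangent_space :: "'a::euclidean_space set set \<Rightarrow> 'a set \<Rightarrow> 'a set" where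
  "tangent_space S p =
     {v. \<exists>c :: real \<Rightarrow> 'a. c 0 \<in> p - {0} \<and> (c has_vector_derivative v) (at 0) \<and>
         (\<forall>\<^sub>F t in nhds 0. c t \<in> \<Union>S)}"

definition tangent_at :: "'a::euclidean_space set set \<Rightarrow> 'a set set \<Rightarrow> 'a set \<Rightarrow> bool" where
  "tangent_at S S' p \<longleftrightarrow> p \<in> S \<and> p \<in> S' \<and> tangent_space S p = tangent_space S' p"

definition tangent_line :: "'a::euclidean_space set set \<Rightarrow> 'a set \<Rightarrow> bool" where
  "tangent_line S l \<longleftrightarrow> l \<in> proj_lines \<and> (\<exists>r\<in>S. r \<subseteq> l \<and> l \<subseteq> tangent_space S r)"

definition transverse_line_at :: "'a::euclidean_space set set \<Rightarrow> 'a set \<Rightarrow> 'a set \<Rightarrow> bool" where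
  "transverse_line_at S p l \<longleftrightarrow>
     p \<in> S \<and> l \<in> lines_through p \<and> \<not> l \<subseteq> tangent_space S p"

text \<open>The framing \<open>p \<mapsto> L(p)\<close> is given by its graph \<open>F\<close>, the set of pairs \<open>(p, L(p))\<close>.\<close>
definition line_framed_hypersurface ::
    "'a::euclidean_space set set \<Rightarrow> ('a set \<times> 'a set) set \<Rightarrow> bool" where
  "line_framed_hypersurface S F \<longleftrightarrow>
     hypersurface S \<and> Domain F = S \<and> single_valued F \<and>
     (\<forall>(p, L)\<in>F. transverse_line_at S p L)"

text \<open>
  The space of lines through \<open>p\<close> is \<open>P(V/p)\<close>. Every linear automorphism of \<open>V/p\<close> lifts to a linear
  automorphism of \<open>V\<close> preserving \<open>p\<close>, so the maps below are the projective transformations of \<open>P(V/p)\<close>.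
\<close>
definition projective_on_pencil ::
    "'a::euclidean_space set \<Rightarrow> ('a set \<Rightarrow> 'a set) \<Rightarrow> bool" where
  "projective_on_pencil p \<phi> \<longleftrightarrow>
     (\<exists>f. linear f \<and> bij f \<and> f ` p = p \<and> (\<forall>l\<in>lines_through p. \<phi> l = f ` l))"

definition is_projective_reflection ::
    "'a::euclidean_space set \<Rightarrow> 'a set \<Rightarrow> 'a set \<Rightarrow> ('a set \<Rightarrow> 'a set) \<Rightarrow> bool" where
  "is_projective_reflection p L T \<phi> \<longleftrightarrow>
     projective_on_pencil p \<phi> \<and>
     (\<forall>l\<in>lines_through p. \<phi> (\<phi> l) = l) \<and>
     (\<exists>l\<in>lines_through p. \<phi> l \<noteq> l) \<and>
     \<phi> L = L \<and>
     (\<forall>l\<in>lines_through p. l \<subseteq> T \<longrightarrow> \<phi> l = l)"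

text \<open>Being \<open>extensional\<close> only fixes the irrelevant values outside the pencil of lines through \<open>p\<close>.\<close>
definition projective_reflection ::
    "'a::euclidean_space set \<Rightarrow> 'a set \<Rightarrow> 'a set \<Rightarrow> 'a set \<Rightarrow> 'a set" where
  "projective_reflection p L T =
     (THE \<phi>. \<phi> \<in> extensional (lines_through p) \<and> is_projective_reflection p L T \<phi>)"

definition caustic ::
    "'a::euclidean_space set set \<Rightarrow> ('a set \<times> 'a set) set \<Rightarrow> bool" where
  "caustic \<Gamma> F \<longleftrightarrow> hypersurface \<Gamma> \<and>
     (\<forall>(p, L)\<in>F. \<forall>l. tangent_line \<Gamma> l \<and> transverse_line_at (Domain F) p l \<longrightarrow>
        tangent_line \<Gamma> (projective_reflection p L (tangent_space (Domain F) p) l))"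

text \<open>The line joining \<open>p\<close> to the pole of the tangent hyperplane of \<open>S\<close> at \<open>p\<close> (if these differ).\<close>
definition pole_line ::
    "('a::euclidean_space \<Rightarrow> real) \<Rightarrow> 'a set set \<Rightarrow> 'a set \<Rightarrow> 'a set" where
  "pole_line q S p = span (p \<union> pole q (tangent_space S p))"

end

theory Submission
  imports Defs
begin

text \<open>
  Let \<open>B\<^sub>1\<close> and \<open>B\<^sub>2\<close> be the polar forms of \<open>q\<^sub>1\<close> and \<open>q\<^sub>2\<close>, and let \<open>p = [x]\<close> be a point of the first
  quadric. Its tangent hyperplane there is the polar hyperplane \<open>T = {v. B\<^sub>1(x, v) = 0}\<close>. Since \<open>q\<^sub>2\<close> is
  non-degenerate, \<open>B\<^sub>1(x, _) = B\<^sub>2(Mx, _)\<close> for a linear automorphism \<open>M\<close>, so that \<open>T\<close> is also the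
  \<open>q\<^sub>2\<close>-orthogonal of \<open>u = Mx\<close> and its pole with respect to \<open>q\<^sub>2\<close> is \<open>[u]\<close>. The pole is \<open>p\<close> exactly when
  the two quadrics are tangent at \<open>p\<close>, and the line \<open>pu\<close> is transverse to the first quadric exactly
  when \<open>B\<^sub>1(x, Mx) = q\<^sub>2(u)\<close> is non-zero. This is an open condition on \<open>x\<close>, hence the points where the
  framing is defined and transverse form a hypersurface with the same tangent hyperplanes as the
  quadric.

  Since \<open>q\<^sub>2(u) \<noteq> 0\<close>, there is a \<open>q\<^sub>2\<close>-orthogonal reflection with axis \<open>u\<close>. It fixes \<open>T\<close> pointwise,
  in particular \<open>x\<close>, and negates \<open>u\<close>. So it induces on the lines through \<open>p\<close> an involution fixing
  \<open>pu\<close> and all lines of \<open>T\<close>: it induces the projective reflection law at \<open>p\<close>,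
  because that law is unique (\<open>projective_reflection_unique\<close>, \<open>projective_reflection_eq_image\<close>). On the other hand it preserves \<open>q\<^sub>2\<close>, hence the second quadric
  and the set of its tangent lines (\<open>tangent_line_isometry_image\<close>). Therefore the second quadric is a
  caustic (\<open>caustic_of_pole_framing\<close>).
\<close>

section \<open>Linear subspaces of small dimension\<close>

lemma proj_points_iff:
  fixes p :: "'a::euclidean_space set"
  shows "p \<in> proj_points \<longleftrightarrow> (\<exists>x. x \<noteq> 0 \<and> p = span {x})"
proof
  assume "p \<in> proj_points"
  then have p: "subspace p" "dim p = 1" by (auto simp: proj_points_def)
  obtain B where B: "B \<subseteq> p" "independent B" "p \<subseteq> span B" "card B = dim p"
    using basis_exists by blast
  obtain x where x: "B = {x}" using B(4) p(2) by (metis card_1_singletonE)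
  have "p = span {x}" using B p(1) x by (metis span_minimal subset_antisym)
  moreover have "x \<noteq> 0" using B(2) x dependent_zero by blast
  ultimately show "\<exists>x. x \<noteq> 0 \<and> p = span {x}" by blast
next
  assume "\<exists>x. x \<noteq> 0 \<and> p = span {x}"
  then show "p \<in> proj_points" by (auto simp: proj_points_def)
qed

lemma proj_point_eq_span:
  fixes p :: "'a::euclidean_space set"
  assumes "p \<in> proj_points" "y \<in> p" "y \<noteq> 0"
  shows "p = span {y}"
proof -
  have "span {y} \<subseteq> p" using assms by (intro span_minimal) (auto simp: proj_points_def)
  moreover have "dim p = dim (span {y})" using assms by (simp add: proj_points_def)
  ultimately show ?thesis
    using assms(1) by (metis mem_Collect_eq order_refl proj_points_def subspace_dim_equal subspace_span)
qed

lemma span_pair_iff: "v \<in> span {x, y} \<longleftrightarrow> (\<exists>a b. v = a *\<^sub>R x + b *\<^sub>R y)"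
  for x y :: "'a::real_vector"
proof
  assume "v \<in> span {x, y}"
  then obtain a where "v - a *\<^sub>R x \<in> span {y}" using span_breakdown_eq by blast
  then obtain b where "v - a *\<^sub>R x = b *\<^sub>R y" by (auto simp: span_singleton)
  then have "v = a *\<^sub>R x + b *\<^sub>R y" by (simp add: algebra_simps)
  then show "\<exists>a b. v = a *\<^sub>R x + b *\<^sub>R y" by blast
next
  assume "\<exists>a b. v = a *\<^sub>R x + b *\<^sub>R y"
  then show "v \<in> span {x, y}" by (auto intro: span_add span_scale span_base)
qed

lemma dim_span_pair:
  fixes x y :: "'a::euclidean_space"
  assumes "x \<noteq> 0" "y \<notin> span {x}"
  shows "dim (span {x, y}) = 2"
proof -
  have "x \<noteq> y" using assms span_base by blast
  moreover have "independent {y, x}"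
    using assms by (simp add: independent_insert)
  ultimately show ?thesis
    by (simp add: dim_eq_card_independent insert_commute)
qed

lemma span_pair_in_lines_through:
  fixes x y :: "'a::euclidean_space"
  assumes "x \<noteq> 0" "y \<notin> span {x}"
  shows "span {x, y} \<in> lines_through (span {x})"
  using dim_span_pair[OF assms]
  by (simp add: lines_through_def proj_lines_def span_mono)

lemma line_eq_span_pair:
  fixes x y :: "'a::euclidean_space"
  assumes l: "l \<in> lines_through (span {x})" and "x \<noteq> 0" "y \<in> l" "y \<notin> span {x}"
  shows "l = span {x, y}"
proof -
  have sub: "subspace l" "dim l = 2" and x: "x \<in> l"
    using l span_base by (fastforce simp: lines_through_def proj_lines_def)+
  have "span {x, y} \<subseteq> l" using sub x assms by (intro span_minimal) auto
  then show ?thesis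
    using sub dim_span_pair[OF \<open>x \<noteq> 0\<close> \<open>y \<notin> span {x}\<close>]
    by (metis order_refl subspace_dim_equal subspace_span)
qed

lemma lines_through_cases:
  fixes x :: "'a::euclidean_space"
  assumes l: "l \<in> lines_through (span {x})" and "x \<noteq> 0"
  obtains y where "y \<notin> span {x}" "l = span {x, y}"
proof -
  have "dim l = 2" using l by (simp add: lines_through_def proj_lines_def)
  moreover have "dim (span {x}) = 1" using \<open>x \<noteq> 0\<close> by simp
  ultimately have "\<not> l \<subseteq> span {x}" using dim_subset[of l "span {x}"] by linarith
  then obtain y where "y \<in> l" "y \<notin> span {x}" by blast
  then show thesis using line_eq_span_pair[OF assms] that by blast
qed

lemma span_pair_eq_span_pair:
  fixes x y :: "'a::real_vector"
  assumes "c \<noteq> 0" "a \<noteq> 0" "z - a *\<^sub>R y \<in> span {x}"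
  shows "span {c *\<^sub>R x, z} = span {x, y}"
proof -
  obtain k where k: "z - a *\<^sub>R y = k *\<^sub>R x" using assms(3) by (auto simp: span_singleton)
  have z: "z = k *\<^sub>R x + a *\<^sub>R y" using k by (simp add: algebra_simps)
  have y: "y = (- (k / (a * c))) *\<^sub>R (c *\<^sub>R x) + (1 / a) *\<^sub>R z"
    using assms(1,2) by (simp add: z algebra_simps)
  have x: "x = (1 / c) *\<^sub>R (c *\<^sub>R x) + 0 *\<^sub>R z" using assms(1) by simp
  have x': "c *\<^sub>R x = c *\<^sub>R x + 0 *\<^sub>R y" by simp
  show ?thesis
    unfolding span_eq insert_subset span_pair_iff using x y z x' by blast
qed

section \<open>Projective reflections\<close>

text \<open>
  The space of lines through \<open>[x]\<close> is the projective space of the quotient by \<open>span {x}\<close>, so two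
  automorphisms that are proportional modulo \<open>x\<close> act on it in the same way.
\<close>
lemma image_line_eq_if_congruent:
  fixes f g :: "'a::euclidean_space \<Rightarrow> 'a"
  assumes "linear f" "linear g" "x \<noteq> 0"
    and fx: "f x = c *\<^sub>R x" "c \<noteq> 0" and gx: "g x = c' *\<^sub>R x" "c' \<noteq> 0"
    and cong: "\<And>v. g v - a *\<^sub>R f v \<in> span {x}" and "a \<noteq> 0"
    and l: "l \<in> lines_through (span {x})"
  shows "g ` l = f ` l"
proof -
  obtain y where y: "l = span {x, y}" using lines_through_cases[OF l \<open>x \<noteq> 0\<close>] by blast
  have "g ` l = span {c' *\<^sub>R x, g y}"
    using linear_span_image[OF \<open>linear g\<close>, of "{x, y}"] y gx by simp
  also have "\<dots> = span {x, f y}"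
    by (rule span_pair_eq_span_pair[OF gx(2) \<open>a \<noteq> 0\<close> cong])
  also have "\<dots> = span {c *\<^sub>R x, f y}"
    by (rule span_pair_eq_span_pair[symmetric, where a = 1]) (use fx in \<open>simp_all add: span_zero\<close>)
  also have "\<dots> = f ` l"
    using linear_span_image[OF \<open>linear f\<close>, of "{x, y}"] y fx by simp
  finally show ?thesis .
qed

text \<open>
  A linear map all of whose vectors are eigenvectors is a scalar; here this is applied to the map
  induced on \<open>T / span {x}\<close>. The vector \<open>t\<close>, non-zero in the quotient, provides the eigenvalue, and
  comparing the eigenvalues of \<open>v\<close>, \<open>t\<close> and \<open>v + t\<close> shows that it is common to all \<open>v\<close>.
\<close>
lemma scalar_mod_point_if_fixes_lines:
  fixes g :: "'a::euclidean_space \<Rightarrow> 'a"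
  assumes g: "linear g" and gx: "g x = c *\<^sub>R x"
    and T: "subspace T" "x \<in> T" "t \<in> T" "t \<notin> span {x}"
    and fixed: "\<And>v. v \<in> T \<Longrightarrow> v \<notin> span {x} \<Longrightarrow> g v \<in> span {x, v}"
  obtains a where "\<And>v. v \<in> T \<Longrightarrow> g v - a *\<^sub>R v \<in> span {x}"
proof -
  have eig: "\<exists>a. g v - a *\<^sub>R v \<in> span {x}" if v: "v \<in> T" "v \<notin> span {x}" for v
  proof -
    obtain k a where "g v = k *\<^sub>R x + a *\<^sub>R v"
      using fixed[OF v] by (auto simp: span_pair_iff)
    then have "g v - a *\<^sub>R v = k *\<^sub>R x" by simp
    then show ?thesis by (metis span_base span_scale singletonI)
  qed
  obtain a where a: "g t - a *\<^sub>R t \<in> span {x}" using eig T by blast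
  have "g v - a *\<^sub>R v \<in> span {x}" if v: "v \<in> T" for v
  proof (cases "v \<in> span {x, t}")
    case True
    then obtain k b where kb: "v = k *\<^sub>R x + b *\<^sub>R t" by (auto simp: span_pair_iff)
    have "g v - a *\<^sub>R v = (k * c - a * k) *\<^sub>R x + b *\<^sub>R (g t - a *\<^sub>R t)"
      by (simp add: kb linear_add[OF g] linear_scale[OF g] gx algebra_simps)
    then show ?thesis using a by (simp add: span_add span_scale span_base)
  next
    case False
    have nv: "v \<notin> span {x}"
      using False span_mono[of "{x}" "{x, t}"] by blast
    have nvt: "v + t \<notin> span {x}"
    proof
      assume "v + t \<in> span {x}"
      then have "v + t \<in> span {x, t}" using span_mono[of "{x}" "{x, t}"] by blast
      then have "(v + t) - t \<in> span {x, t}" by (intro span_diff) (auto intro: span_base)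
      then show False using False by simp
    qed
    obtain b where b: "g v - b *\<^sub>R v \<in> span {x}" using eig v nv by blast
    obtain s where s: "g (v + t) - s *\<^sub>R (v + t) \<in> span {x}"
      using eig[OF _ nvt] T v subspace_add by blast
    have "(g v - b *\<^sub>R v) + (g t - a *\<^sub>R t) - (g (v + t) - s *\<^sub>R (v + t)) \<in> span {x}"
      by (rule span_diff[OF span_add[OF b a] s])
    then have *: "(s - b) *\<^sub>R v + (s - a) *\<^sub>R t \<in> span {x}"
      by (simp add: linear_add[OF g] algebra_simps)
    have sb: "s = b"
    proof (rule ccontr)
      assume "s \<noteq> b"
      have "(s - b) *\<^sub>R v + (s - a) *\<^sub>R t \<in> span {x, t}"
        using * span_mono[of "{x}" "{x, t}"] by blast
      then have "((s - b) *\<^sub>R v + (s - a) *\<^sub>R t) - (s - a) *\<^sub>R t \<in> span {x, t}"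
        by (intro span_diff) (auto intro: span_base span_scale)
      then have "(s - b) *\<^sub>R v \<in> span {x, t}" by simp
      then have "(1 / (s - b)) *\<^sub>R ((s - b) *\<^sub>R v) \<in> span {x, t}" by (rule span_scale)
      then show False using False \<open>s \<noteq> b\<close> by simp
    qed
    have "s = a"
    proof (rule ccontr)
      assume "s \<noteq> a"
      have "(s - a) *\<^sub>R t \<in> span {x}" using * sb by simp
      then have "(1 / (s - a)) *\<^sub>R ((s - a) *\<^sub>R t) \<in> span {x}" by (rule span_scale)
      then show False using T \<open>s \<noteq> a\<close> by simp
    qed
    then show ?thesis using b sb by simp
  qed
  then show thesis using that by blast
qed

text \<open>
  A linear reflection \<open>f\<close> in the hyperplane \<open>T\<close> along \<open>u\<close> satisfies the reflection law. It is non-trivial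
  on the pencil because it moves the line through \<open>[x]\<close> and \<open>[u + t]\<close> to the one through \<open>[x]\<close> and
  \<open>[t - u]\<close>, and these differ since \<open>t\<close> is not on \<open>[x]\<close>.
\<close>
lemma reflection_is_projective_reflection:
  fixes f :: "'a::euclidean_space \<Rightarrow> 'a"
  assumes "x \<noteq> 0" and T: "subspace T" "x \<in> T" "t \<in> T" "t \<notin> span {x}"
    and u: "u \<notin> T" and compl: "\<And>v. \<exists>k. v - k *\<^sub>R u \<in> T"
    and f: "linear f" "\<And>v. v \<in> T \<Longrightarrow> f v = v" "f u = - u"
  shows "is_projective_reflection (span {x}) (span {x, u}) T
           (restrict ((`) f) (lines_through (span {x})))"
proof -
  let ?P = "lines_through (span {x})"
  have xT: "span {x} \<subseteq> T" using T by (simp add: span_minimal)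
  have fx: "f x = x" using f T by blast
  have ff: "f (f v) = v" for v
  proof -
    obtain k where "v - k *\<^sub>R u \<in> T" using compl by blast
    moreover define w where "w = v - k *\<^sub>R u"
    ultimately have w: "w \<in> T" "v = w + k *\<^sub>R u" by auto
    then have "f v = w - k *\<^sub>R u" using f by (simp add: linear_add linear_scale)
    then show ?thesis using w f by (simp add: linear_diff linear_scale)
  qed
  have bij: "bij f" by (rule o_bij[of f f]) (auto simp: ff)
  have img: "f ` span {x, y} = span {x, f y}" for y
    using linear_span_image[OF f(1), of "{x, y}"] fx by simp
  have img_x: "f ` span {x} = span {x}"
    using linear_span_image[OF f(1), of "{x}"] fx by simp
  have nspan: "f y \<notin> span {x}" if "y \<notin> span {x}" for y
    using that ff xT f(2) by (metis subsetD)
  have img_line: "f ` l \<in> ?P" if l: "l \<in> ?P" for l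
  proof -
    obtain y where "y \<notin> span {x}" "l = span {x, y}"
      using lines_through_cases[OF l \<open>x \<noteq> 0\<close>] by blast
    then show ?thesis using span_pair_in_lines_through \<open>x \<noteq> 0\<close> nspan img by metis
  qed
  have ux: "u \<notin> span {x}" using u xT by blast
  have utT: "u + t \<notin> T"
    using u T by (metis add_diff_cancel_right' subspace_diff)
  have ut: "u + t \<notin> span {x}" using utT xT by blast
  have moved: "f ` span {x, u + t} \<noteq> span {x, u + t}"
  proof
    assume "f ` span {x, u + t} = span {x, u + t}"
    then have "f (u + t) \<in> span {x, u + t}" by (metis imageI span_base insertI1 insertI2)
    then have "- u + t \<in> span {x, u + t}" using f T by (simp add: linear_add)
    then have "(- u + t) + (u + t) \<in> span {x, u + t}"
      by (rule span_add) (simp add: span_base)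
    then have "(1/2) *\<^sub>R ((- u + t) + (u + t)) \<in> span {x, u + t}" by (rule span_scale)
    moreover have "(1/2) *\<^sub>R ((- u + t) + (u + t)) = t" by (simp flip: scaleR_2)
    ultimately obtain a b where ab: "t = a *\<^sub>R x + b *\<^sub>R (u + t)"
      by (auto simp: span_pair_iff)
    have "b *\<^sub>R (u + t) = t - a *\<^sub>R x" using ab by (simp add: algebra_simps)
    also have "\<dots> \<in> T" using T by (intro subspace_diff subspace_scale)
    finally have "(1 / b) *\<^sub>R (b *\<^sub>R (u + t)) \<in> T" using T(1) by (rule subspace_scale[rotated])
    then have "b = 0" using utT by (cases "b = 0") auto
    then show False using ab T(4) by (auto simp: span_singleton)
  qed
  have "f ` span {x, u} = span {x, u}"
    unfolding img using span_pair_eq_span_pair[of 1 "-1" "f u" u x] f by (simp add: span_zero)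
  moreover have "f ` l = l" if "l \<subseteq> T" for l using that f(2) by force
  ultimately show ?thesis
    unfolding is_projective_reflection_def projective_on_pencil_def
    using f(1) bij img_x img_line moved span_pair_in_lines_through[OF \<open>x \<noteq> 0\<close> ut]
      span_pair_in_lines_through[OF \<open>x \<noteq> 0\<close> ux]
    by (auto simp: image_image ff)
qed

text \<open>
  Let \<open>g\<close> induce \<open>\<psi>\<close>. Modulo \<open>x\<close>, it acts on \<open>T\<close> as a scalar \<open>a\<close>, because it fixes all the lines of \<open>T\<close>
  through \<open>[x]\<close>, and it multiplies \<open>u\<close> by a scalar \<open>b\<close>. Being an involution on the line through \<open>[x]\<close>
  and \<open>[u + t]\<close> forces \<open>a\<^sup>2 = b\<^sup>2\<close>; if \<open>a = b\<close> then \<open>\<psi>\<close> would be trivial, so \<open>b = - a\<close> and \<open>g\<close> is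
  proportional to \<open>f\<close> modulo \<open>x\<close>.
\<close>
lemma projective_reflection_unique:
  fixes f :: "'a::euclidean_space \<Rightarrow> 'a"
  assumes "x \<noteq> 0" and T: "subspace T" "x \<in> T" "t \<in> T" "t \<notin> span {x}"
    and u: "u \<notin> T" and compl: "\<And>v. \<exists>k. v - k *\<^sub>R u \<in> T"
    and f: "linear f" "\<And>v. v \<in> T \<Longrightarrow> f v = v" "f u = - u"
    and psi: "is_projective_reflection (span {x}) (span {x, u}) T \<psi>"
    and m: "m \<in> lines_through (span {x})"
  shows "\<psi> m = f ` m"
proof -
  let ?P = "lines_through (span {x})"
  have xT: "span {x} \<subseteq> T" using T by (simp add: span_minimal)
  have xs: "x \<in> span {x}" by (simp add: span_base)
  have "projective_on_pencil (span {x}) \<psi>"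
    using psi by (simp add: is_projective_reflection_def)
  then obtain g where g: "linear g" "bij g" "g ` span {x} = span {x}"
    and psig: "\<And>l. l \<in> ?P \<Longrightarrow> \<psi> l = g ` l"
    unfolding projective_on_pencil_def by (elim exE conjE) (rule that; simp)
  have invol: "\<And>l. l \<in> ?P \<Longrightarrow> \<psi> (\<psi> l) = l"
    and nontriv: "\<exists>l\<in>?P. \<psi> l \<noteq> l"
    and fixL: "\<psi> (span {x, u}) = span {x, u}"
    and fixT: "\<And>l. l \<in> ?P \<Longrightarrow> l \<subseteq> T \<Longrightarrow> \<psi> l = l"
    using psi unfolding is_projective_reflection_def by auto
  have injg: "g v = 0 \<longleftrightarrow> v = 0" for v
    using g(1,2) by (metis bij_is_inj injD linear_0)
  obtain c where gx: "g x = c *\<^sub>R x"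
    using g(3) xs by (metis imageI span_singleton rangeE)
  have c: "c \<noteq> 0" using gx injg \<open>x \<noteq> 0\<close> by (metis scaleR_zero_left)
  have gspan: "g v \<in> span {x}" if "v \<in> span {x}" for v using that g(3) by blast
  have g_in: "g y \<in> \<psi> (span {x, y})" if "y \<notin> span {x}" for y
    using psig[OF span_pair_in_lines_through[OF \<open>x \<noteq> 0\<close> that]]
    by (metis imageI insertI1 insertI2 span_base)
  have fixlines: "g v \<in> span {x, v}" if "v \<in> T" "v \<notin> span {x}" for v
    using g_in[OF that(2)] fixT[OF span_pair_in_lines_through[OF \<open>x \<noteq> 0\<close> that(2)]]
      that T by (simp add: span_minimal)
  obtain a where a: "\<And>v. v \<in> T \<Longrightarrow> g v - a *\<^sub>R v \<in> span {x}"
    using scalar_mod_point_if_fixes_lines[OF g(1) gx T fixlines] by blast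
  have ux: "u \<notin> span {x}" using u xT by blast
  obtain k b where "g u = k *\<^sub>R x + b *\<^sub>R u"
    using g_in[OF ux] fixL by (auto simp: span_pair_iff)
  then have b: "g u - b *\<^sub>R u \<in> span {x}" using xs by (simp add: span_scale)
  have gT: "g (g v) - (a * a) *\<^sub>R v \<in> span {x}" if "v \<in> T" for v
  proof -
    have "g (g v - a *\<^sub>R v) + a *\<^sub>R (g v - a *\<^sub>R v) \<in> span {x}"
      using a[OF that] gspan by (intro span_add span_scale) auto
    then show ?thesis by (simp add: linear_diff[OF g(1)] linear_scale[OF g(1)] algebra_simps)
  qed
  have gu: "g (g u) - (b * b) *\<^sub>R u \<in> span {x}"
  proof -
    have "g (g u - b *\<^sub>R u) + b *\<^sub>R (g u - b *\<^sub>R u) \<in> span {x}"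
      using b gspan by (intro span_add span_scale) auto
    then show ?thesis by (simp add: linear_diff[OF g(1)] linear_scale[OF g(1)] algebra_simps)
  qed
  have a0: "a \<noteq> 0"
  proof
    assume "a = 0"
    then have "g t \<in> g ` span {x}" using a[OF T(3)] g(3) by simp
    then have "t \<in> span {x}" using g(2) by (simp add: bij_is_inj inj_image_mem_iff)
    then show False using T by blast
  qed
  have ab: "a * a = b * b"
  proof -
    have utT: "u + t \<notin> T" using u T by (metis add_diff_cancel_right' subspace_diff)
    then have ut: "u + t \<notin> span {x}" using xT by blast
    have L: "span {x, u + t} \<in> ?P" by (rule span_pair_in_lines_through[OF \<open>x \<noteq> 0\<close> ut])
    have "\<psi> (span {x, u + t}) \<in> ?P"
    proof -
      have "g (u + t) \<notin> span {x}"
      proof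
        assume "g (u + t) \<in> span {x}"
        then have "g (u + t) \<in> g ` span {x}" using g(3) by simp
        then show False using ut g(2) by (simp add: bij_is_inj inj_image_mem_iff)
      qed
      moreover have "g ` span {x, u + t} = span {x, g (u + t)}"
        using linear_span_image[OF g(1), of "{x, u + t}"] gx
          span_pair_eq_span_pair[OF c one_neq_zero, of "g (u + t)" "g (u + t)" x]
        by (simp add: span_zero)
      ultimately show ?thesis
        using psig[OF L] span_pair_in_lines_through[OF \<open>x \<noteq> 0\<close>] by simp
    qed
    then have "g ` g ` span {x, u + t} = span {x, u + t}"
      using psig invol L by metis
    then have "g (g (u + t)) \<in> span {x, u + t}"
      by (metis imageI insertI1 insertI2 span_base)
    then obtain r s where rs: "g (g (u + t)) = r *\<^sub>R x + s *\<^sub>R (u + t)"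
      by (auto simp: span_pair_iff)
    have "(g (g u) - (b * b) *\<^sub>R u) + (g (g t) - (a * a) *\<^sub>R t) - r *\<^sub>R x \<in> span {x}"
      by (rule span_diff[OF span_add[OF gu gT[OF T(3)]] span_scale[OF xs]])
    moreover have "g (g u) + g (g t) = r *\<^sub>R x + s *\<^sub>R (u + t)"
      using rs by (simp add: linear_add[OF g(1)])
    then have "(g (g u) - (b * b) *\<^sub>R u) + (g (g t) - (a * a) *\<^sub>R t) - r *\<^sub>R x
        = (s - b * b) *\<^sub>R u + (s - a * a) *\<^sub>R t"
      by (simp add: algebra_simps)
    ultimately have *: "(s - b * b) *\<^sub>R u + (s - a * a) *\<^sub>R t \<in> span {x}" by simp
    have sb: "s = b * b"
    proof (rule ccontr)
      assume "s \<noteq> b * b"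
      have "((s - b * b) *\<^sub>R u + (s - a * a) *\<^sub>R t) - (s - a * a) *\<^sub>R t \<in> T"
        using * xT T by (intro subspace_diff subspace_scale) auto
      then have "(s - b * b) *\<^sub>R u \<in> T" by simp
      then have "(1 / (s - b * b)) *\<^sub>R ((s - b * b) *\<^sub>R u) \<in> T"
        by (rule subspace_scale[OF T(1)])
      then show False using u \<open>s \<noteq> b * b\<close> by simp
    qed
    have "s = a * a"
    proof (rule ccontr)
      assume "s \<noteq> a * a"
      have "(s - a * a) *\<^sub>R t \<in> span {x}" using * sb by simp
      then have "(1 / (s - a * a)) *\<^sub>R ((s - a * a) *\<^sub>R t) \<in> span {x}" by (rule span_scale)
      then show False using T \<open>s \<noteq> a * a\<close> by simp
    qed
    then show ?thesis using sb by simp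
  qed
  have "a \<noteq> b"
  proof
    assume "a = b"
    have cong: "g v - a *\<^sub>R id v \<in> span {x}" for v
    proof -
      obtain k where k: "v - k *\<^sub>R u \<in> T" using compl by blast
      have "(g (v - k *\<^sub>R u) - a *\<^sub>R (v - k *\<^sub>R u)) + k *\<^sub>R (g u - b *\<^sub>R u) \<in> span {x}"
        using a[OF k] b by (intro span_add span_scale)
      then show ?thesis
        using \<open>a = b\<close> by (simp add: linear_diff[OF g(1)] linear_scale[OF g(1)] algebra_simps)
    qed
    have "\<psi> l = l" if "l \<in> ?P" for l
      using image_line_eq_if_congruent[OF linear_id g(1) \<open>x \<noteq> 0\<close> _ _ gx c cong a0 that, of 1]
        psig[OF that] by simp
    then show False using nontriv by blast
  qed
  then have ba: "b = - a" using ab by (metis square_eq_iff)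
  have cong: "g v - a *\<^sub>R f v \<in> span {x}" for v
  proof -
    obtain k where k: "v - k *\<^sub>R u \<in> T" using compl by blast
    have fv: "f v = (v - k *\<^sub>R u) - k *\<^sub>R u"
      using f(2)[OF k] f(3) by (simp add: linear_diff[OF f(1)] linear_scale[OF f(1)] algebra_simps)
    have "(g (v - k *\<^sub>R u) - a *\<^sub>R (v - k *\<^sub>R u)) + k *\<^sub>R (g u - b *\<^sub>R u) \<in> span {x}"
      using a[OF k] b by (intro span_add span_scale)
    then show ?thesis
      using ba by (simp add: fv linear_diff[OF g(1)] linear_scale[OF g(1)] algebra_simps)
  qed
  show ?thesis
    using image_line_eq_if_congruent[OF f(1) g(1) \<open>x \<noteq> 0\<close> _ _ gx c cong a0 m, of 1]
      psig[OF m] f(2)[OF T(2)] by simp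
qed

lemma projective_reflection_eq_image:
  fixes f :: "'a::euclidean_space \<Rightarrow> 'a"
  assumes "x \<noteq> 0" and T: "subspace T" "x \<in> T" "t \<in> T" "t \<notin> span {x}"
    and u: "u \<notin> T" and compl: "\<And>v. \<exists>k. v - k *\<^sub>R u \<in> T"
    and f: "linear f" "\<And>v. v \<in> T \<Longrightarrow> f v = v" "f u = - u"
    and l: "l \<in> lines_through (span {x})"
  shows "projective_reflection (span {x}) (span {x, u}) T l = f ` l"
proof -
  let ?P = "lines_through (span {x})"
  let ?\<phi> = "restrict ((`) f) ?P"
  have unique: "\<psi> m = f ` m"
    if "is_projective_reflection (span {x}) (span {x, u}) T \<psi>" "m \<in> ?P" for \<psi> m
    using projective_reflection_unique[OF assms(1-10) that] .
  have "projective_reflection (span {x}) (span {x, u}) T = ?\<phi>"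
    unfolding projective_reflection_def
  proof (rule the_equality, safe)
    show "is_projective_reflection (span {x}) (span {x, u}) T ?\<phi>"
      by (rule reflection_is_projective_reflection) (use assms in auto)
  next
    fix \<psi> assume "\<psi> \<in> extensional ?P" "is_projective_reflection (span {x}) (span {x, u}) T \<psi>"
    then show "\<psi> = ?\<phi>" using unique by (intro extensionalityI[of _ ?P]) auto
  qed auto
  then show ?thesis using l by simp
qed

section \<open>Quadratic forms and their quadrics\<close>

lemma polar_form_self:
  assumes "quadratic_form q"
  shows "polar_form q x x = q x"
  using assms unfolding quadratic_form_def polar_form_def
  by (auto simp: bilinear_ladd bilinear_radd)

lemma polar_form_commute: "polar_form q x y = polar_form q y x"
  by (simp add: polar_form_def add.commute)

lemma bilinear_polar_form:
  assumes "quadratic_form q"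
  shows "bilinear (polar_form q)"
proof -
  obtain B where B: "bilinear B" "\<And>x. q x = B x x"
    using assms unfolding quadratic_form_def by blast
  have "polar_form q x y = (B x y + B y x) / 2" for x y
    unfolding polar_form_def B(2) using B(1) by (simp add: bilinear_ladd bilinear_radd)
  then show ?thesis
    unfolding bilinear_def
    by (auto intro!: linearI simp: bilinear_ladd[OF B(1)] bilinear_radd[OF B(1)]
        bilinear_lmul[OF B(1)] bilinear_rmul[OF B(1)] algebra_simps add_divide_distrib)
qed

lemma polar_form_gradient:
  fixes q :: "'a::euclidean_space \<Rightarrow> real"
  assumes "quadratic_form q"
  obtains A where "linear A" "\<And>x y. polar_form q x y = A x \<bullet> y"
proof -
  note B = bilinear_polar_form[OF assms]
  let ?A = "\<lambda>x. \<Sum>b\<in>Basis. polar_form q x b *\<^sub>R b"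
  have "linear ?A"
    by (rule linearI)
       (simp_all add: bilinear_ladd[OF B] bilinear_lmul[OF B] scaleR_add_left sum.distrib
         scaleR_sum_right)
  moreover have "polar_form q x y = ?A x \<bullet> y" for x y
  proof -
    have lin: "linear (polar_form q x)" using B by (simp add: bilinear_def)
    have "polar_form q x y = polar_form q x (\<Sum>b\<in>Basis. (y \<bullet> b) *\<^sub>R b)"
      by (simp add: euclidean_representation)
    also have "\<dots> = (\<Sum>b\<in>Basis. (y \<bullet> b) * polar_form q x b)"
      by (simp add: linear_sum[OF lin] linear_scale[OF lin])
    also have "\<dots> = ?A x \<bullet> y"
      by (simp add: inner_sum_left mult.commute) (simp add: inner_commute)
    finally show ?thesis .
  qed
  ultimately show thesis using that by blast
qed

lemma GDERIV_quadratic_form: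
  fixes q :: "'a::euclidean_space \<Rightarrow> real"
  assumes q: "quadratic_form q" and A: "\<And>x y. polar_form q x y = A x \<bullet> y"
  shows "GDERIV q x :> 2 *\<^sub>R A x"
proof -
  have bb: "bounded_bilinear (polar_form q)"
    using bilinear_polar_form[OF q] by (simp add: bilinear_conv_bounded_bilinear)
  have "((\<lambda>y. polar_form q y y) has_derivative (\<lambda>h. polar_form q x h + polar_form q h x)) (at x)"
    by (rule bounded_bilinear.FDERIV[OF bb has_derivative_ident has_derivative_ident])
  then have "(q has_derivative (\<lambda>h. 2 * polar_form q x h)) (at x)"
    by (simp add: polar_form_self[OF q] polar_form_commute[of q _ x])
  then show ?thesis by (simp add: gderiv_def A inner_commute)
qed

text \<open>
  The open set \<open>N\<close> allows for a quadric (\<open>N\<close> is the complement of the origin) as well as for its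
  relatively open subsets. The gradient of a non-degenerate form vanishes only at the origin.
\<close>
lemma hypersurface_in_quadric:
  fixes q :: "'a::euclidean_space \<Rightarrow> real"
  assumes q: "nondegenerate_form q" and S: "S \<subseteq> proj_points"
    and N: "open N" "0 \<notin> N" and cone: "\<Union>S - {0} = {y \<in> N. q y = 0}"
  shows "hypersurface S"
proof -
  have qf: "quadratic_form q" using q by (simp add: nondegenerate_form_def)
  obtain A where A: "linear A" "\<And>x y. polar_form q x y = A x \<bullet> y"
    using polar_form_gradient[OF qf] by blast
  have "A y \<noteq> 0" if "y \<in> N" for y
    using q A(2) that N(2) unfolding nondegenerate_form_def by force
  moreover have "continuous_on N (\<lambda>y. 2 *\<^sub>R A y)"
    using A(1) by (intro continuous_intros linear_continuous_on) (simp add: linear_conv_bounded_linear)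
  moreover have "\<Union>S \<inter> N = {y \<in> N. q y = 0}" using cone N by blast
  moreover have "x \<in> N" if "p \<in> S" "x \<in> p - {0}" for p x using cone that by blast
  ultimately show ?thesis
    unfolding hypersurface_def
    using S N(1) GDERIV_quadratic_form[OF qf A(2)]
    by (intro conjI ballI exI[of _ N] exI[of _ q] exI[of _ "\<lambda>y. 2 *\<^sub>R A y"]) auto
qed

text \<open>
  Choose an isotropic \<open>z\<close> with \<open>B(x, z) = 1/2\<close>. The value of \<open>q\<close> at \<open>x + t v + s z\<close> is then
  \<open>t\<^sup>2 q(v) + s (1 + 2 t B(v, z))\<close>, which is affine in \<open>s\<close>: solving for \<open>s\<close> gives a rational curve
  whose correction term \<open>s\<close> is of second order in \<open>t\<close>.
\<close>
lemma isotropic_curve: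
  fixes q :: "'a::euclidean_space \<Rightarrow> real"
  assumes q: "nondegenerate_form q" and x: "x \<noteq> 0" "q x = 0" "polar_form q x v = 0"
  obtains c where "c 0 = x" "(c has_vector_derivative v) (at 0)" "\<forall>\<^sub>F t in nhds (0::real). q (c t) = 0"
proof -
  have qf: "quadratic_form q" using q by (simp add: nondegenerate_form_def)
  note B = bilinear_polar_form[OF qf]
  note B_simps = bilinear_ladd[OF B] bilinear_radd[OF B] bilinear_lmul[OF B] bilinear_rmul[OF B]
    bilinear_lsub[OF B] bilinear_rsub[OF B]
  note self = polar_form_self[OF qf]
  obtain y where y: "polar_form q x y \<noteq> 0"
    using q x(1) unfolding nondegenerate_form_def by blast
  define z0 where "z0 = (1 / (2 * polar_form q x y)) *\<^sub>R y"
  have z0: "polar_form q x z0 = 1/2" using y by (simp add: z0_def B_simps)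
  \<comment> \<open>Moving \<open>z0\<close> along the isotropic vector \<open>x\<close> makes it isotropic without changing \<open>B(x, z0)\<close>.\<close>
  define z where "z = z0 - q z0 *\<^sub>R x"
  have xz: "polar_form q x z = 1/2" using z0 x by (simp add: z_def B_simps self)
  have "q z = polar_form q z z" by (simp add: self)
  also have "\<dots> = 0"
    using z0 x polar_form_commute[of q z0 x]
    by (simp add: z_def B_simps self[of x] self[of z0])
  finally have qz: "q z = 0" .
  define b where "b = polar_form q v z"
  define s where "s t = - (t^2 * q v) / (1 + 2 * t * b)" for t
  define c where "c t = x + t *\<^sub>R v + s t *\<^sub>R z" for t
  have "(s has_real_derivative 0) (at 0)"
    unfolding s_def by (auto intro!: derivative_eq_intros)
  then have "(c has_vector_derivative v) (at 0)"
    unfolding c_def by (auto intro!: derivative_eq_intros)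
  moreover have "c 0 = x" by (simp add: c_def s_def)
  moreover have "\<forall>\<^sub>F t in nhds 0. q (c t) = 0"
  proof -
    have "open {t. 1 + 2 * t * b \<noteq> 0}"
      by (intro open_Collect_neq continuous_intros)
    then have "\<forall>\<^sub>F t in nhds 0. 1 + 2 * t * b \<noteq> 0"
      unfolding eventually_nhds by fastforce
    then show ?thesis
    proof eventually_elim
      case (elim t)
      have "q (c t) = polar_form q (c t) (c t)" by (simp add: self)
      also have "\<dots> = t^2 * q v + s t * (1 + 2 * t * b)"
        using x xz qz
        by (simp add: c_def B_simps self[of x] self[of v] self[of z] b_def polar_form_commute[of q z x]
            polar_form_commute[of q z v] polar_form_commute[of q v x]
            power2_eq_square algebra_simps)
      also have "\<dots> = 0" using elim by (simp add: s_def)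
      finally show ?case .
    qed
  qed
  ultimately show thesis using that by blast
qed

text \<open>
  Differentiating \<open>q(c t) = 0\<close> shows that velocities are orthogonal to \<open>c 0\<close>, a multiple of \<open>x\<close>. For the
  converse, a curve of isotropic vectors starting at \<open>x\<close> stays for a while in the open set \<open>N\<close>.
\<close>
lemma tangent_space_in_quadric:
  fixes q :: "'a::euclidean_space \<Rightarrow> real"
  assumes q: "nondegenerate_form q"
    and N: "open N" "0 \<notin> N" and cone: "\<Union>S - {0} = {y \<in> N. q y = 0}"
    and x: "x \<in> N" "q x = 0"
  shows "tangent_space S (span {x}) = {v. polar_form q x v = 0}"
proof (intro equalityI subsetI CollectI)
  have qf: "quadratic_form q" using q by (simp add: nondegenerate_form_def)
  note B = bilinear_polar_form[OF qf]
  fix v assume "v \<in> tangent_space S (span {x})"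
  then obtain c where c: "c (0::real) \<in> span {x} - {0}" "(c has_vector_derivative v) (at 0)"
      "\<forall>\<^sub>F t in nhds 0. c t \<in> \<Union>S"
    unfolding tangent_space_def by blast
  obtain a where a: "c 0 = a *\<^sub>R x" "a \<noteq> 0" using c(1) by (auto simp: span_singleton)
  have zero: "\<forall>\<^sub>F t in nhds 0. q (c t) = 0"
    using c(3)
  proof eventually_elim
    case (elim t)
    moreover have "q 0 = 0" using polar_form_self[OF qf, of 0] bilinear_lzero[OF B] by simp
    ultimately show ?case using cone by (cases "c t = 0") auto
  qed
  have bb: "bounded_bilinear (polar_form q)"
    using B by (simp add: bilinear_conv_bounded_bilinear)
  have "((\<lambda>t. polar_form q (c t) (c t)) has_vector_derivative
          polar_form q (c 0) v + polar_form q v (c 0)) (at 0)"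
    by (rule bounded_bilinear.has_vector_derivative[OF bb c(2) c(2)])
  then have 1: "((\<lambda>t. q (c t)) has_vector_derivative 2 * (a * polar_form q x v)) (at 0)"
    by (simp add: polar_form_self[OF qf] polar_form_commute[of q v] a bilinear_lmul[OF B])
  have zero_at: "\<forall>\<^sub>F t in at 0. q (c t) = 0" and "q (c 0) = 0"
    using zero by (auto simp: eventually_nhds_conv_at)
  then have 2: "((\<lambda>t. q (c t)) has_vector_derivative 0) (at 0)"
    using has_derivative_transform_eventually[of "\<lambda>_. 0" "\<lambda>_. 0" 0 UNIV "\<lambda>t. q (c t)"]
    by (simp add: has_vector_derivative_def eq_commute[of 0])
  have "2 * (a * polar_form q x v) = 0" by (rule vector_derivative_unique_at[OF 1 2])
  then show "polar_form q x v = 0" using a by simp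
next
  fix v assume "v \<in> {v. polar_form q x v = 0}"
  then have "polar_form q x v = 0" by simp
  moreover have "x \<noteq> 0" using x N by blast
  ultimately obtain c where c: "c 0 = x" "(c has_vector_derivative v) (at 0)"
      "\<forall>\<^sub>F t in nhds (0::real). q (c t) = 0"
    using isotropic_curve[OF q _ x(2)] by blast
  have "isCont c 0" using c(2) has_vector_derivative_continuous by blast
  then have "\<forall>\<^sub>F t in nhds 0. c t \<in> N"
    using N(1) x(1) c(1) unfolding continuous_at by (metis eventually_nhds_conv_at topological_tendstoD)
  with c(3) have "\<forall>\<^sub>F t in nhds 0. c t \<in> \<Union>S"
  proof eventually_elim
    case (elim t)
    then show ?case using cone by blast
  qed
  moreover have "c 0 \<in> span {x} - {0}" using c(1) \<open>x \<noteq> 0\<close> by (simp add: span_base)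
  ultimately show "v \<in> tangent_space S (span {x})"
    unfolding tangent_space_def using c(2) by blast
qed

lemma quadric_iff:
  fixes q :: "'a::euclidean_space \<Rightarrow> real"
  assumes "quadratic_form q"
  shows "p \<in> quadric q \<longleftrightarrow> (\<exists>x. x \<noteq> 0 \<and> q x = 0 \<and> p = span {x})"
proof -
  note B = bilinear_polar_form[OF assms]
  have "q (a *\<^sub>R x) = a^2 * q x" for a x
    using polar_form_self[OF assms, of "a *\<^sub>R x"] polar_form_self[OF assms, of x]
    by (simp add: bilinear_lmul[OF B] bilinear_rmul[OF B] power2_eq_square)
  then show ?thesis
    by (auto simp: quadric_def proj_points_iff span_singleton)
qed

lemma cone_quadric:
  fixes q :: "'a::euclidean_space \<Rightarrow> real"
  assumes "quadratic_form q"
  shows "\<Union>(quadric q) - {0} = {y \<in> - {0}. q y = 0}"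
proof -
  have "q y = 0" if "p \<in> quadric q" "y \<in> p" for p y using that by (auto simp: quadric_def)
  moreover have "span {y} \<in> quadric q" if "y \<noteq> 0" "q y = 0" for y
    using that quadric_iff[OF assms] by blast
  ultimately show ?thesis by (auto intro: span_base)
qed

lemma hypersurface_quadric:
  fixes q :: "'a::euclidean_space \<Rightarrow> real"
  assumes "nondegenerate_form q"
  shows "hypersurface (quadric q)"
  using assms
  by (intro hypersurface_in_quadric[OF assms _ _ _ cone_quadric])
     (auto simp: nondegenerate_form_def quadric_def)

lemma tangent_space_quadric:
  fixes q :: "'a::euclidean_space \<Rightarrow> real"
  assumes "nondegenerate_form q" "x \<noteq> 0" "q x = 0"
  shows "tangent_space (quadric q) (span {x}) = {v. polar_form q x v = 0}"
  using assms
  by (intro tangent_space_in_quadric[OF assms(1) _ _ cone_quadric])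
     (auto simp: nondegenerate_form_def)

text \<open>
  An isometry of \<open>q\<close> carries the tangent hyperplane at \<open>[x]\<close>, the polar hyperplane of \<open>x\<close>, to the
  tangent hyperplane at \<open>[f x]\<close>.
\<close>
lemma tangent_line_isometry_image:
  fixes q :: "'a::euclidean_space \<Rightarrow> real"
  assumes q: "nondegenerate_form q" and f: "linear f" "inj f" "\<And>v. q (f v) = q v"
    and l: "tangent_line (quadric q) l"
  shows "tangent_line (quadric q) (f ` l)"
proof -
  have qf: "quadratic_form q" using q by (simp add: nondegenerate_form_def)
  have pf: "polar_form q (f v) (f w) = polar_form q v w" for v w
    by (simp add: polar_form_def f(3) flip: linear_add[OF f(1)])
  obtain r where r: "r \<in> quadric q" "r \<subseteq> l" "l \<subseteq> tangent_space (quadric q) r"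
    and line: "l \<in> proj_lines"
    using l unfolding tangent_line_def by blast
  obtain x where x: "x \<noteq> 0" "q x = 0" "r = span {x}" using r(1) quadric_iff[OF qf] by blast
  have fx: "f x \<noteq> 0" "q (f x) = 0" using x f by (auto simp: linear_injective_0)
  have fr: "f ` r = span {f x}" using linear_span_image[OF f(1), of "{x}"] x by simp
  have "f ` l \<subseteq> tangent_space (quadric q) (f ` r)"
    using r(3) pf unfolding x(3) fr[unfolded x(3)] tangent_space_quadric[OF q x(1,2)]
      tangent_space_quadric[OF q fx] by auto
  moreover have "f ` r \<in> quadric q" using fr fx quadric_iff[OF qf] by blast
  moreover have "f ` l \<in> proj_lines"
  proof -
    have "dim (f ` l) = dim l"
      by (rule dim_image_eq[OF f(1) inj_on_subset[OF f(2) subset_UNIV]])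
    moreover have "subspace (f ` l)"
      using line by (intro linear_subspace_image[OF f(1)]) (simp add: proj_lines_def)
    ultimately show ?thesis using line by (simp add: proj_lines_def)
  qed
  moreover have "f ` r \<subseteq> f ` l" using r(2) by (rule image_mono)
  ultimately show ?thesis unfolding tangent_line_def by (intro conjI bexI[of _ "f ` r"])
qed

section \<open>The framing of a quadric by poles with respect to another\<close>

text \<open>
  Two linear forms with the same kernel are proportional; this is applied to \<open>B(v, _)\<close> and \<open>B(u, _)\<close>.
\<close>
lemma pole_polar_hyperplane:
  fixes q :: "'a::euclidean_space \<Rightarrow> real"
  assumes q: "nondegenerate_form q" and "u \<noteq> 0"
  shows "pole q {w. polar_form q u w = 0} = span {u}"
proof (intro equalityI subsetI)
  have "quadratic_form q" using q by (simp add: nondegenerate_form_def)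
  note B = bilinear_polar_form[OF this]
  note B_simps = bilinear_lmul[OF B] bilinear_rmul[OF B] bilinear_lsub[OF B] bilinear_rsub[OF B]
  {
    fix v assume v: "v \<in> pole q {w. polar_form q u w = 0}"
    obtain y where y: "polar_form q u y \<noteq> 0"
      using q \<open>u \<noteq> 0\<close> unfolding nondegenerate_form_def by blast
    define k where "k = polar_form q v y / polar_form q u y"
    have "polar_form q (v - k *\<^sub>R u) w = 0" for w
    proof -
      have "polar_form q u (w - (polar_form q u w / polar_form q u y) *\<^sub>R y) = 0"
        using y by (simp add: B_simps)
      then have "polar_form q v (w - (polar_form q u w / polar_form q u y) *\<^sub>R y) = 0"
        using v unfolding pole_def by blast
      then show ?thesis by (simp add: B_simps k_def)
    qed
    then have "v - k *\<^sub>R u = 0" using q unfolding nondegenerate_form_def by blast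
    then have "v = k *\<^sub>R u" by simp
    then show "v \<in> span {u}" by (simp only: span_singleton) (rule rangeI)
  next
    fix v assume "v \<in> span {u}"
    then show "v \<in> pole q {w. polar_form q u w = 0}"
      by (auto simp: span_singleton pole_def B_simps)
  }
qed

text \<open>
  In terms of the matrices \<open>A\<^sub>1\<close> and \<open>A\<^sub>2\<close> of the two forms, \<open>M\<close> is \<open>A\<^sub>2\<^sup>-\<^sup>1 A\<^sub>1\<close>. It describes poles: the
  pole with respect to \<open>q2\<close> of the tangent hyperplane of \<open>quadric q1\<close> at \<open>[x]\<close> is \<open>[M x]\<close>.
\<close>
lemma relative_polarity:
  fixes q1 q2 :: "'a::euclidean_space \<Rightarrow> real"
  assumes q1: "nondegenerate_form q1" and q2: "nondegenerate_form q2"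
  obtains M where "linear M" "\<And>x y. polar_form q2 (M x) y = polar_form q1 x y"
    "\<And>x. x \<noteq> 0 \<Longrightarrow> M x \<noteq> 0"
proof -
  have qf: "quadratic_form q1" "quadratic_form q2"
    using q1 q2 by (simp_all add: nondegenerate_form_def)
  obtain A1 where A1: "linear A1" "\<And>x y. polar_form q1 x y = A1 x \<bullet> y"
    using polar_form_gradient[OF qf(1)] by blast
  obtain A2 where A2: "linear A2" "\<And>x y. polar_form q2 x y = A2 x \<bullet> y"
    using polar_form_gradient[OF qf(2)] by blast
  have inj1: "x = 0" if "A1 x = 0" for x
    using q1 that unfolding nondegenerate_form_def A1(2) by simp
  have "inj A2"
    using q2 unfolding nondegenerate_form_def A2(2) by (simp add: linear_injective_0[OF A2(1)])
  then obtain A2' where A2': "linear A2'" "\<And>x. A2 (A2' x) = x"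
    using linear_injective_isomorphism[OF A2(1)] by blast
  have "linear (A2' \<circ> A1)" using linear_compose A1(1) A2'(1) by blast
  moreover have "polar_form q2 ((A2' \<circ> A1) x) y = polar_form q1 x y" for x y
    by (simp add: A1 A2 A2')
  moreover have "(A2' \<circ> A1) x \<noteq> 0" if "x \<noteq> 0" for x
    using inj1 that A2'(2) linear_0[OF A2(1)] by (metis comp_apply)
  ultimately show thesis using that by blast
qed

text \<open>The orthogonal reflection with axis \<open>u\<close> in the quadratic space defined by \<open>q\<close>.\<close>
definition form_reflection ::
    "('a::euclidean_space \<Rightarrow> real) \<Rightarrow> 'a \<Rightarrow> 'a \<Rightarrow> 'a" where
  "form_reflection q u v = v - (2 * polar_form q v u / q u) *\<^sub>R u"

lemma form_reflection:
  assumes q: "quadratic_form q" and u: "q u \<noteq> 0"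
  shows "linear (form_reflection q u)"
    and "form_reflection q u u = - u"
    and "inj (form_reflection q u)"
    and "q (form_reflection q u v) = q v"
proof -
  let ?f = "form_reflection q u"
  note B = bilinear_polar_form[OF q]
  note B_simps = bilinear_ladd[OF B] bilinear_lmul[OF B] bilinear_lsub[OF B]
    bilinear_rmul[OF B] bilinear_rsub[OF B]
  note self = polar_form_self[OF q]
  show "linear ?f"
    by (rule linearI) (simp_all add: form_reflection_def B_simps algebra_simps add_divide_distrib)
  show "?f u = - u"
    using u by (simp add: form_reflection_def self scaleR_2)
  have "polar_form q (?f v) u = - polar_form q v u" for v
    using u by (simp add: form_reflection_def B_simps self[of u])
  then have "?f (?f v) = v" for v
    unfolding form_reflection_def[of q u "?f v"] by (simp add: form_reflection_def)
  then show "inj ?f" by (metis injI)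
  have "q (?f v) = polar_form q (?f v) (?f v)" by (simp add: self)
  also have "\<dots> = q v"
    using u by (simp add: form_reflection_def B_simps self[of u] self[of v]
        polar_form_commute[of q u v])
  finally show "q (?f v) = q v" .
qed

text \<open>
  The bound on the dimension says that the tangent hyperplane contains lines through \<open>p\<close>; otherwise
  there would be a single line through \<open>p\<close> and no reflection.
\<close>
lemma caustic_of_pole_framing:
  fixes q1 q2 :: "'a::euclidean_space \<Rightarrow> real"
  assumes dim: "DIM('a) \<ge> 3"
    and q1: "nondegenerate_form q1" and q2: "nondegenerate_form q2"
    and U: "U = {p \<in> quadric q1. \<not> tangent_at (quadric q1) (quadric q2) p \<and>
                   transverse_line_at (quadric q1) p (pole_line q2 (quadric q1) p)}"
    and F: "F = {(p, pole_line q2 (quadric q1) p) | p. p \<in> U}"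
  shows "\<And>p. p \<in> quadric q1 \<Longrightarrow> \<not> tangent_at (quadric q1) (quadric q2) p \<Longrightarrow>
            pole q2 (tangent_space (quadric q1) p) \<in> proj_points \<and>
            pole q2 (tangent_space (quadric q1) p) \<noteq> p"
    and "line_framed_hypersurface U F"
    and "caustic (quadric q2) F"
proof -
  let ?Q1 = "quadric q1" and ?Q2 = "quadric q2"
  let ?B1 = "polar_form q1" and ?B2 = "polar_form q2"
  have qf1: "quadratic_form q1" and qf2: "quadratic_form q2"
    using q1 q2 by (simp_all add: nondegenerate_form_def)
  note B1 = bilinear_polar_form[OF qf1] and B2 = bilinear_polar_form[OF qf2]
  note self1 = polar_form_self[OF qf1] and self2 = polar_form_self[OF qf2]
  obtain M where M: "linear M" "\<And>x y. ?B2 (M x) y = ?B1 x y" "\<And>x. x \<noteq> 0 \<Longrightarrow> M x \<noteq> 0"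
    using relative_polarity[OF q1 q2] by blast
  note T1 = tangent_space_quadric[OF q1] and T2 = tangent_space_quadric[OF q2]
  have pole_eq: "pole q2 (tangent_space ?Q1 (span {x})) = span {M x}"
    if "x \<noteq> 0" "q1 x = 0" for x
    using pole_polar_hyperplane[OF q2 M(3)[OF that(1)]] by (simp add: T1[OF that] M(2))
  have tangent_iff: "tangent_at ?Q1 ?Q2 (span {x}) \<longleftrightarrow> M x \<in> span {x}"
    if x: "x \<noteq> 0" "q1 x = 0" for x
  proof
    assume t: "tangent_at ?Q1 ?Q2 (span {x})"
    then have "q2 x = 0" unfolding tangent_at_def quadric_def by (auto simp: span_base)
    then have "pole q2 (tangent_space ?Q2 (span {x})) = span {x}"
      using pole_polar_hyperplane[OF q2 x(1)] by (simp add: T2 x)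
    then have "span {M x} = span {x}" using t pole_eq[OF x] unfolding tangent_at_def by simp
    then show "M x \<in> span {x}" by (metis insertI1 span_base)
  next
    assume "M x \<in> span {x}"
    then obtain k where k: "M x = k *\<^sub>R x" by (auto simp: span_singleton)
    have k0: "k \<noteq> 0" using k M(3)[OF x(1)] by auto
    have eq: "?B1 x v = k * ?B2 x v" for v
      using M(2)[of x v] by (simp add: k bilinear_lmul[OF B2])
    have q2x: "q2 x = 0" using eq[of x] x(2) k0 by (simp add: self1 self2)
    show "tangent_at ?Q1 ?Q2 (span {x})"
      unfolding tangent_at_def
      using x q2x k0 quadric_iff[OF qf1] quadric_iff[OF qf2] by (auto simp: T1 T2 eq)
  qed
  show "pole q2 (tangent_space ?Q1 p) \<in> proj_points \<and> pole q2 (tangent_space ?Q1 p) \<noteq> p"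
    if p: "p \<in> ?Q1" "\<not> tangent_at ?Q1 ?Q2 p" for p
  proof -
    obtain x where x: "x \<noteq> 0" "q1 x = 0" "p = span {x}" using p(1) quadric_iff[OF qf1] by blast
    have "M x \<notin> p" using tangent_iff[OF x(1,2)] p(2) x(3) by simp
    then show ?thesis
      using x M(3) by (auto simp: pole_eq proj_points_iff span_base)
  qed
  have L_eq: "pole_line q2 ?Q1 (span {x}) = span {x, M x}" if "x \<noteq> 0" "q1 x = 0" for x
    unfolding pole_line_def pole_eq[OF that]
    by (intro equalityI span_minimal Un_least span_mono subspace_span) (auto intro: span_base)
  have U_iff: "span {x} \<in> U \<longleftrightarrow> ?B1 x (M x) \<noteq> 0" if x: "x \<noteq> 0" "q1 x = 0" for x
  proof -
    have Bx: "?B1 x x = 0" using x self1 by simp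
    have T: "v \<in> tangent_space ?Q1 (span {x}) \<longleftrightarrow> ?B1 x v = 0" for v using T1[OF x] by simp
    have "span {x} \<in> ?Q1" using x quadric_iff[OF qf1] by blast
    moreover have "M x \<notin> span {x}" if "?B1 x (M x) \<noteq> 0"
      using that Bx by (auto simp: span_singleton bilinear_rmul[OF B1])
    moreover have "span {x, M x} \<subseteq> tangent_space ?Q1 (span {x}) \<longleftrightarrow> ?B1 x (M x) = 0"
    proof
      assume "span {x, M x} \<subseteq> tangent_space ?Q1 (span {x})"
      then have "M x \<in> tangent_space ?Q1 (span {x})" by (auto intro: span_base)
      then show "?B1 x (M x) = 0" by (simp only: T)
    next
      assume "?B1 x (M x) = 0"
      then show "span {x, M x} \<subseteq> tangent_space ?Q1 (span {x})"
        using Bx by (auto simp: T span_pair_iff bilinear_radd[OF B1] bilinear_rmul[OF B1])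
    qed
    ultimately show ?thesis
      unfolding U using span_pair_in_lines_through[OF x(1)]
      by (auto simp: tangent_iff[OF x] L_eq[OF x] transverse_line_at_def)
  qed
  define N where "N = {x. ?B1 x (M x) \<noteq> 0}"
  \<comment> \<open>\<open>B\<^sub>1(x, M x)\<close> is a quadratic form in \<open>x\<close>, so \<open>U\<close> is a relatively open part of the quadric.\<close>
  have N: "open N" "0 \<notin> N"
  proof -
    have bb: "bounded_bilinear ?B1" using B1 by (simp add: bilinear_conv_bounded_bilinear)
    have M_cont: "continuous_on UNIV M"
      using M(1) by (simp add: linear_continuous_on linear_conv_bounded_linear)
    have "continuous_on UNIV (\<lambda>x. ?B1 x (M x))"
      by (rule bounded_bilinear.continuous_on[OF bb continuous_on_id M_cont])
    then show "open N" unfolding N_def by (intro open_Collect_neq continuous_on_const)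
    show "0 \<notin> N" by (simp add: N_def bilinear_lzero[OF B1])
  qed
  have UQ1: "U \<subseteq> ?Q1" using U by blast
  have cone: "\<Union>U - {0} = {y \<in> N. q1 y = 0}"
  proof (intro equalityI subsetI)
    fix y assume "y \<in> \<Union>U - {0}"
    then obtain p where p: "p \<in> U" "y \<in> p" "y \<noteq> 0" by blast
    then have y: "q1 y = 0" using UQ1 by (auto simp: quadric_def)
    have "p \<in> proj_points" using p(1) UQ1 by (auto simp: quadric_def)
    then have "p = span {y}" using p by (intro proj_point_eq_span)
    then show "y \<in> {y \<in> N. q1 y = 0}" using U_iff[OF p(3) y] p(1) y by (simp add: N_def)
  next
    fix y assume "y \<in> {y \<in> N. q1 y = 0}"
    then have y: "y \<noteq> 0" "q1 y = 0" "?B1 y (M y) \<noteq> 0" using N(2) by (auto simp: N_def)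
    have "span {y} \<in> U" using U_iff[OF y(1,2)] y(3) by simp
    moreover have "y \<in> span {y}" by (simp add: span_base)
    ultimately show "y \<in> \<Union>U - {0}" using y(1) by blast
  qed
  have U_cases: "\<exists>x. p = span {x} \<and> x \<noteq> 0 \<and> q1 x = 0 \<and> x \<in> N" if p: "p \<in> U" for p
  proof -
    have "p \<in> ?Q1" using p UQ1 by blast
    then obtain x where x: "x \<noteq> 0" "q1 x = 0" "p = span {x}"
      using quadric_iff[OF qf1] by blast
    then show ?thesis using U_iff[OF x(1,2)] p by (auto simp: N_def)
  qed
  have TU: "tangent_space U (span {x}) = {v. ?B1 x v = 0}" if "x \<in> N" "q1 x = 0" for x
    by (rule tangent_space_in_quadric[OF q1 N cone that])
  have trans: "transverse_line_at U p (pole_line q2 ?Q1 p)" if p: "p \<in> U" for p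
  proof -
    obtain x where x: "p = span {x}" "x \<noteq> 0" "q1 x = 0" "x \<in> N" using U_cases[OF p] by blast
    have "tangent_space U p = tangent_space ?Q1 p" using TU[of x] T1[of x] x by simp
    then show ?thesis using p unfolding U transverse_line_at_def by auto
  qed
  have domF: "Domain F = U" using F by auto
  have "hypersurface U"
    by (rule hypersurface_in_quadric[OF q1 _ N cone]) (use UQ1 in \<open>auto simp: quadric_def\<close>)
  then show "line_framed_hypersurface U F"
    unfolding line_framed_hypersurface_def using domF trans F
    by (auto simp: single_valued_def)
  have "tangent_line ?Q2 (projective_reflection p L (tangent_space U p) l)"
    if pL: "(p, L) \<in> F" and l: "tangent_line ?Q2 l" "transverse_line_at U p l" for p L l
  proof -
    have p: "p \<in> U" "L = pole_line q2 ?Q1 p" using pL F by auto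
    obtain x where x: "p = span {x}" "x \<noteq> 0" "q1 x = 0" "x \<in> N" using U_cases[OF p(1)] by blast
    \<comment> \<open>\<open>T\<close> is also the \<open>q2\<close>-orthogonal of the pole \<open>u\<close>, so the \<open>q2\<close>-reflection along \<open>u\<close> fixes it pointwise.\<close>
    define u where "u = M x"
    define T where "T = tangent_space U p"
    have T: "T = {v. ?B1 x v = 0}" unfolding T_def using TU x by simp
    have Bu: "?B2 u v = ?B1 x v" for v by (simp add: u_def M(2))
    have Bu': "?B2 v u = ?B1 x v" for v by (simp add: Bu polar_form_commute[of q2 v])
    have q2u: "q2 u \<noteq> 0" using x(4) by (simp add: N_def u_def M(2) flip: self2)
    have uT: "u \<notin> T" using x(4) by (simp add: T N_def u_def)
    have subT: "subspace T" unfolding T subspace_def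
      by (simp add: bilinear_rzero[OF B1] bilinear_radd[OF B1] bilinear_rmul[OF B1])
    have compl: "\<exists>k. v - k *\<^sub>R u \<in> T" for v
      using uT by (auto intro!: exI[of _ "?B1 x v / ?B1 x u"]
          simp: T bilinear_rsub[OF B1] bilinear_rmul[OF B1])
    have xT: "x \<in> T" using x self1 by (simp add: T)
    have "\<not> T \<subseteq> span {x}"
    proof
      assume *: "T \<subseteq> span {x}"
      have "v \<in> span {x, u}" for v
      proof -
        obtain k where "v - k *\<^sub>R u \<in> T" using compl by blast
        then show ?thesis using * span_breakdown_eq by (metis insert_commute subsetD)
      qed
      then have "DIM('a) \<le> card {x, u}"
        using dim_le_card[of UNIV "{x, u}"] by (simp add: subsetI)
      also have "card {x, u} \<le> 2" by (simp add: card_insert_if)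
      finally show False using dim by simp
    qed
    then obtain t where t: "t \<in> T" "t \<notin> span {x}" by blast
    define f where "f = form_reflection q2 u"
    note f_refl = form_reflection[OF qf2 q2u, folded f_def]
    have fT: "f v = v" if "v \<in> T" for v
      using that by (simp add: f_def form_reflection_def T Bu')
    note f = f_refl(1) fT f_refl(2)
    have "projective_reflection p L T l = f ` l"
      using projective_reflection_eq_image[OF x(2) subT xT t uT compl f, of l] l(2)
      by (simp add: p(2) x(1) L_eq[OF x(2,3)] u_def transverse_line_at_def)
    moreover have "tangent_line ?Q2 (f ` l)"
      by (rule tangent_line_isometry_image[OF q2 f_refl(1,3,4) l(1)])
    ultimately show ?thesis by (simp add: T_def)
  qed
  then show "caustic ?Q2 F"
    unfolding caustic_def domF using hypersurface_quadric[OF q2] by blast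
qed

theorem proposition2p37:
  fixes d :: nat
    and q1 q2 :: "real ^ 'n \<Rightarrow> real"
    and Q1 Q2 U :: "(real ^ 'n) set set"
    and \<Sigma> :: "((real ^ 'n) set \<times> (real ^ 'n) set) set"
  assumes "d \<ge> 2" and "CARD('n) = d + 1"
    and "nondegenerate_form q1" and "nondegenerate_form q2"
    and "Q1 = quadric q1" and "Q2 = quadric q2"
    and "Q1 \<noteq> {}" and "Q2 \<noteq> {}" and "Q1 \<noteq> Q2"
    and "U = {p \<in> Q1. \<not> tangent_at Q1 Q2 p \<and> transverse_line_at Q1 p (pole_line q2 Q1 p)}"
    and "\<Sigma> = {(p, pole_line q2 Q1 p) | p. p \<in> U}"
  shows "(\<forall>p\<in>Q1. \<not> tangent_at Q1 Q2 p \<longrightarrow>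
            pole q2 (tangent_space Q1 p) \<in> proj_points \<and> pole q2 (tangent_space Q1 p) \<noteq> p)
       \<and> line_framed_hypersurface U \<Sigma>
       \<and> caustic Q2 \<Sigma>"
proof -
  have "DIM(real ^ 'n) \<ge> 3" using assms(1,2) by simp
  note main = caustic_of_pole_framing[OF this assms(3,4) assms(10,11)[unfolded assms(5,6)]]
  then show ?thesis using assms(5,6) by blast
qed

end
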